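(* Let $k\ge 2$ and let $n\ge 2$ be even. If $k\in\{2,3\}$ then the datacenter network $\mathrm{DPillar}_{n,k}$ has diameter $k$; and if $k\ge 4$ then the datacenter network $\mathrm{DPillar}_{n,k}$ has diameter $k+\lfloor\frac k2\rfloor-2$.
   Context: For $k\ge 2$ and even $n\ge 2$, the digraph $\mathrm{DPillar}_{n,k}$ abstracting the datacenter network is defined as follows. Its nodes (servers) are the pairs $(c,v_{k-1}v_{k-2}\ldots v_0)$ with $0\le c\le k-1$ and $0\le v_i\le \frac n2-1$ for all $0\le i\le k-1$; $c$ is the column-index and $v_{k-1}\ldots v_0$ the row-index, and $v_i$ is the bit in position $i$. Column-indices and bit positions are taken modulo $k$. From a node $(c,v_{k-1}\ldots v_0)$ there are directed edges to the following nodes, where $*$ denotes an arbitrary value in $\{0,1,\ldots,\frac n2-1\}$: (i) c-edges: to the node in column $c+1$ whose row-index is obtained by replacing $v_c$ with $*$; (ii) a-edges: to the node in column $c-1$ whose row-index is obtained by replacing $v_{c-1}$ with $*$; (iii) b-edges: to the node in column $c$ whose row-index is obtained by replacing $v_c$ with $*\ne v_c$; (iv) d-edges: to the node in column $c$ whose row-index is obtained by replacing $v_{c-1}$ with $*\neq v_{c-1}$. Each edge corresponds to a server-switch-server link-pair in the physical network, and the length of a path between servers is its number of edges (i.e. of server-switch-server link-pairs). The diameter is the maximum, over all pairs of distinct servers, of the length of a shortest path joining them.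
   Formalization: The case n = 2 is excluded (n is even and at least 4): for n = 2 every bit is 0, so the network is a bidirected cycle on k servers of diameter ⌊k/2⌋, and the claimed value fails for every k ≥ 2. *)

theory Defs
  imports "Graph_Theory.Graph_Theory" "HOL-Library.FuncSet"
begin

text \<open>
  Hop distance is the library's \<open>\<mu>\<close> (infimum of walk costs, \<open>\<infinity>\<close> if there is no walk) with unit
  arc costs. On a finite digraph with at least two vertices the supremum below ranges over a finite
  nonempty set, so it is a maximum; it is \<open>\<infinity>\<close> if the digraph is not strongly connected.
\<close>

definition digraph_diameter :: "('a, 'b) pre_digraph \<Rightarrow> ereal" where
  "digraph_diameter G =
     (SUP (u, v) \<in> {(u, v). u \<in> verts G \<and> v \<in> verts G \<and> u \<noteq> v}. wf_digraph.\<mu> G (\<lambda>_. 1) u v)"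

text \<open>
  A server is a pair \<open>(c, v)\<close>; the row-index \<open>v\<close> is an extensional function on positions
  \<open>0, \<dots>, k - 1\<close>, with \<open>v i\<close> the bit in position \<open>i\<close>.
\<close>

type_synonym server = "nat \<times> (nat \<Rightarrow> nat)"

definition dpillar_nodes :: "nat \<Rightarrow> nat \<Rightarrow> server set" where
  "dpillar_nodes n k = {0..<k} \<times> ({0..<k} \<rightarrow>\<^sub>E {0..<n div 2})"

definition next_col :: "nat \<Rightarrow> nat \<Rightarrow> nat" where
  "next_col k c = (c + 1) mod k"

definition prev_col :: "nat \<Rightarrow> nat \<Rightarrow> nat" where
  "prev_col k c = (c + k - 1) mod k"

definition c_edges :: "nat \<Rightarrow> nat \<Rightarrow> (server \<times> server) set" where
  "c_edges n k = {((c, v), (next_col k c, v(c := x))) | c v x.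
     (c, v) \<in> dpillar_nodes n k \<and> x \<in> {0..<n div 2}}"

definition a_edges :: "nat \<Rightarrow> nat \<Rightarrow> (server \<times> server) set" where
  "a_edges n k = {((c, v), (prev_col k c, v(prev_col k c := x))) | c v x.
     (c, v) \<in> dpillar_nodes n k \<and> x \<in> {0..<n div 2}}"

definition b_edges :: "nat \<Rightarrow> nat \<Rightarrow> (server \<times> server) set" where
  "b_edges n k = {((c, v), (c, v(c := x))) | c v x.
     (c, v) \<in> dpillar_nodes n k \<and> x \<in> {0..<n div 2} \<and> x \<noteq> v c}"

definition d_edges :: "nat \<Rightarrow> nat \<Rightarrow> (server \<times> server) set" where
  "d_edges n k = {((c, v), (c, v(prev_col k c := x))) | c v x.
     (c, v) \<in> dpillar_nodes n k \<and> x \<in> {0..<n div 2} \<and> x \<noteq> v (prev_col k c)}"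

text \<open>
  Parallel edges are identified (for \<open>k = 2\<close> a c-edge and an a-edge can have the same endpoints);
  this does not affect distances.
\<close>

definition DPillar :: "nat \<Rightarrow> nat \<Rightarrow> server pair_pre_digraph" where
  "DPillar n k = \<lparr> pverts = dpillar_nodes n k,
     parcs = c_edges n k \<union> a_edges n k \<union> b_edges n k \<union> d_edges n k \<rparr>"

lemma dpillar_nodes_upd:
  assumes "(c, v) \<in> dpillar_nodes n k" "c' < k" "i < k" "x < n div 2"
  shows "(c', v(i := x)) \<in> dpillar_nodes n k"
  using assms by (auto simp: dpillar_nodes_def PiE_iff extensional_def)

lemma dpillar_nodes_col: "(c, v) \<in> dpillar_nodes n k \<Longrightarrow> c < k"
  by (simp add: dpillar_nodes_def)

lemma pair_fin_digraph_DPillar: "pair_fin_digraph (DPillar n k)"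
proof -
  let ?E = "parcs (DPillar n k)"
  have sub: "?E \<subseteq> dpillar_nodes n k \<times> dpillar_nodes n k"
    by (auto simp: DPillar_def c_edges_def a_edges_def b_edges_def d_edges_def
        next_col_def prev_col_def dest: dpillar_nodes_col simp del: fun_upd_apply
        intro!: dpillar_nodes_upd mod_less_divisor)
  have fin: "finite (dpillar_nodes n k)"
    unfolding dpillar_nodes_def by (intro finite_cartesian_product finite_PiE) auto
  have V: "pverts (DPillar n k) = dpillar_nodes n k"
    by (simp add: DPillar_def)
  show ?thesis
    using sub fin finite_subset[OF sub] by unfold_locales (auto simp: V)
qed

lemma wf_digraph_DPillar: "wf_digraph (with_proj (DPillar n k))"
proof -
  interpret pair_fin_digraph "DPillar n k" by (rule pair_fin_digraph_DPillar)
  show ?thesis by (rule wf_digraph_axioms)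
qed

text \<open>
  For \<open>n = 2\<close> every bit is 0, so the digraph is a bidirected cycle on the \<open>k\<close> columns. Its diameter
  is less than \<open>k\<close>, which is why \<open>n = 2\<close> must be excluded from any claim that the diameter is at
  least \<open>k\<close>.
\<close>

lemma digraph_diameter_DPillar_2: "digraph_diameter (DPillar 2 k) \<le> ereal (real k - 1)"
proof -
  interpret wf_digraph "with_proj (DPillar 2 k)" by (rule wf_digraph_DPillar)
  define r where "r = (\<lambda>i\<in>{0..<k}. 0 :: nat)"
  have nodes: "dpillar_nodes 2 k = {0..<k} \<times> {r}"
    by (auto simp: dpillar_nodes_def r_def PiE_iff extensional_def fun_eq_iff)
  have V: "verts (with_proj (DPillar 2 k)) = {0..<k} \<times> {r}"
    by (simp add: DPillar_def nodes)
  have step: "((c, r), ((c + 1) mod k, r)) \<in> parcs (DPillar 2 k)" if "c < k" for c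
  proof -
    have "r(c := 0) = r" using that by (auto simp: r_def)
    then have "((c, r), ((c + 1) mod k, r)) \<in> c_edges 2 k"
      using that by (force simp: c_edges_def nodes next_col_def)
    then show ?thesis by (simp add: DPillar_def)
  qed
  have walk: "\<exists>p. awalk (c, r) p ((c + d) mod k, r) \<and> length p = d" if "c < k" for c d
    using that
  proof (induction d arbitrary: c)
    case 0
    then have "(c, r) \<in> verts (with_proj (DPillar 2 k))" by (simp only: V) simp
    with 0 show ?case by (simp add: awalk_Nil_iff)
  next
    case (Suc d)
    have "(c + 1) mod k < k" using Suc.prems by simp
    from Suc.IH[OF this] obtain p
      where "awalk ((c + 1) mod k, r) p ((c + Suc d) mod k, r)" "length p = d"
      by (auto simp: mod_simps)
    then have "awalk (c, r) (((c, r), ((c + 1) mod k, r)) # p) ((c + Suc d) mod k, r)"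
      using step[OF Suc.prems] by (simp add: awalk_Cons_iff)
    with \<open>length p = d\<close> show ?case by (metis length_Cons)
  qed
  have cost: "awalk_cost (\<lambda>_. 1) p = real (length p)" for p :: "(server \<times> server) list"
    by (induction p) auto
  have "\<mu> (\<lambda>_. 1) (c, r) (c', r) \<le> ereal (real k - 1)" if c: "c < k" "c' < k" for c c'
  proof -
    define d where "d = (c' + k - c) mod k"
    have "(c + d) mod k = c'" using c by (simp add: d_def mod_simps)
    moreover have "d < k" using c by (simp add: d_def)
    ultimately obtain p where "awalk (c, r) p (c', r)" "length p = d"
      using walk[OF c(1), of d] by auto
    then have "\<mu> (\<lambda>_. 1) (c, r) (c', r) \<le> ereal (real d)"
      using min_cost_le_walk_cost cost by metis
    also have "\<dots> \<le> ereal (real k - 1)" using \<open>d < k\<close> by simp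
    finally show ?thesis .
  qed
  then show ?thesis
    unfolding digraph_diameter_def V by (auto intro!: SUP_least)
qed

end

theory Submission
  imports Defs
begin

text \<open>
  View the columns as the vertices of a cycle of length \<open>k\<close> and bit position \<open>i\<close> as the cycle edge
  between columns \<open>i\<close> and \<open>i + 1\<close>. One hop either traverses a cycle edge or stays put, and in both
  cases it may rewrite the bit of one incident cycle edge. So a path between servers is a walk on
  the cycle that touches every cycle edge whose bit must change. Lifted to the integers, a walk
  with range \<open>[-a, b]\<close> ending in \<open>p\<close> has at least \<open>2a + 2b - |p|\<close> moves, and staying put gains at
  most one further edge at either end of the range. Touching all \<open>k\<close> edges therefore costs at
  least \<open>2k - 2 - |p|\<close> (and at least \<open>|p|\<close>). For \<open>|p| \<le> k - 2\<close> this is attained by turning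
  around once, and \<open>k\<close> hops suffice if the columns are equal or adjacent. A target column at
  cyclic distance \<open>k div 2\<close> is the worst case for \<open>k \<ge> 4\<close>.
\<close>

section \<open>Walks and relation powers\<close>

lemma (in wf_digraph) awalk_cost_unit: "awalk_cost (\<lambda>_. 1) p = real (length p)"
  by (induction p) auto

lemma (in pair_wf_digraph) awalk_imp_relpow:
  "awalk u p w \<Longrightarrow> (u, w) \<in> parcs G ^^ length p"
proof (induction p arbitrary: u)
  case Nil
  then show ?case by (simp add: awalk_Nil_iff)
next
  case (Cons e p)
  then show ?case
    by (cases e) (auto simp: awalk_Cons_iff simp del: relpow.simps intro: relpow_Suc_I2)
qed

text \<open>The reflexive closure admits idle steps, so routes need only be built up to a length
  bound; dropping the idle steps leaves a genuine walk.\<close>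

lemma (in pair_wf_digraph) reflcl_relpow_imp_awalk:
  "(u, w) \<in> ((parcs G)\<^sup>=) ^^ l \<Longrightarrow> u \<in> pverts G \<Longrightarrow> \<exists>p. awalk u p w \<and> length p \<le> l"
proof (induction l arbitrary: u)
  case 0
  then have "awalk u [] w" by (simp add: awalk_Nil_iff)
  then show ?case by force
next
  case (Suc l)
  obtain x where x: "(u, x) \<in> (parcs G)\<^sup>=" "(x, w) \<in> ((parcs G)\<^sup>=) ^^ l"
    using Suc.prems(1) by (meson relpow_Suc_D2)
  have "x \<in> pverts G" using x(1) Suc.prems(2) by (auto dest: in_arcsD2)
  from Suc.IH[OF x(2) this] obtain p where p: "awalk x p w" "length p \<le> l" by blast
  show ?case
  proof (cases "u = x")
    case True
    then show ?thesis using p le_SucI by blast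
  next
    case False
    then have "awalk u ((u, x) # p) w" using x(1) p(1) by (simp add: awalk_Cons_iff)
    then show ?thesis using p(2) by (metis Suc_le_mono length_Cons)
  qed
qed

context
  fixes n k :: nat
begin

interpretation D: pair_fin_digraph "DPillar n k" by (rule pair_fin_digraph_DPillar)

lemma digraph_diameter_DPillar_le:
  assumes "\<And>u w. u \<in> dpillar_nodes n k \<Longrightarrow> w \<in> dpillar_nodes n k \<Longrightarrow>
    (u, w) \<in> ((parcs (DPillar n k))\<^sup>=) ^^ l"
  shows "digraph_diameter (with_proj (DPillar n k)) \<le> ereal (real l)"
proof -
  have "D.\<mu> (\<lambda>_. 1) u w \<le> ereal (real l)"
    if uw: "u \<in> dpillar_nodes n k" "w \<in> dpillar_nodes n k" for u w
  proof -
    obtain p where p: "D.awalk u p w" "length p \<le> l"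
      using D.reflcl_relpow_imp_awalk[OF assms[OF uw]] uw(1) by (auto simp: DPillar_def)
    have "D.\<mu> (\<lambda>_. 1) u w \<le> ereal (real (length p))"
      using D.min_cost_le_walk_cost[OF p(1)] D.awalk_cost_unit by metis
    also have "\<dots> \<le> ereal (real l)" using p(2) by simp
    finally show ?thesis .
  qed
  then show ?thesis
    unfolding digraph_diameter_def by (auto intro!: SUP_least simp: DPillar_def)
qed

lemma digraph_diameter_DPillar_ge:
  assumes uw: "u \<in> dpillar_nodes n k" "w \<in> dpillar_nodes n k" "u \<noteq> w"
    and len: "\<And>t. (u, w) \<in> parcs (DPillar n k) ^^ t \<Longrightarrow> l \<le> t"
  shows "ereal (real l) \<le> digraph_diameter (with_proj (DPillar n k))"
proof -
  have "ereal (real l) \<le> D.\<mu> (\<lambda>_. 1) u w"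
    unfolding D.\<mu>_def
    by (rule INF_greatest) (auto simp: D.awalk_cost_unit dest!: D.awalk_imp_relpow len)
  also have "\<dots> \<le> digraph_diameter (with_proj (DPillar n k))"
    unfolding digraph_diameter_def using uw by (intro SUP_upper2[of "(u, w)"]) (auto simp: DPillar_def)
  finally show ?thesis .
qed

end

section \<open>Lower bound\<close>

lemma DPillar_arcE:
  assumes "((c, v), (c', v')) \<in> parcs (DPillar n k)"
  obtains (up) x where "c < k" "c' = next_col k c" "v' = v(c := x)"
  | (down) x where "c < k" "c' = prev_col k c" "v' = v(prev_col k c := x)"
  | (stay_next) x where "c < k" "c' = c" "v' = v(c := x)"
  | (stay_prev) x where "c < k" "c' = c" "v' = v(prev_col k c := x)"
  using assms
  by (auto simp: DPillar_def c_edges_def a_edges_def b_edges_def d_edges_def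
      dest: dpillar_nodes_col)

lemma int_next_col: "int c = p mod int k \<Longrightarrow> int (next_col k c) = (p + 1) mod int k"
  by (simp add: next_col_def zmod_int mod_simps add.commute)

lemma int_prev_col:
  assumes "c < k" "int c = p mod int k"
  shows "int (prev_col k c) = (p - 1) mod int k"
proof -
  have "int (prev_col k c) = (int c - 1 + int k) mod int k"
    using assms(1) by (simp add: prev_col_def zmod_int algebra_simps)
  also have "\<dots> = (p - 1) mod int k" by (simp add: assms(2) mod_simps)
  finally show ?thesis .
qed

text \<open>
  \<open>x\<close> and \<open>y\<close> record whether the outermost edges \<open>-A\<close> and \<open>B - 1\<close> of the touched interval were
  touched only by staying put, so the range of the lifted walk is \<open>[-A + x, B - y]\<close>.
\<close>

lemma DPillar_walk_invariant:
  assumes "((0, v), (c, w)) \<in> parcs (DPillar n k) ^^ t" "k > 0"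
  shows "\<exists>p A B x y :: int. int c = p mod int k \<and> 0 \<le> x \<and> x \<le> 1 \<and> 0 \<le> y \<and> y \<le> 1 \<and>
    x \<le> A \<and> y \<le> B \<and> x - A \<le> p \<and> p \<le> B - y \<and>
    2 * A + 2 * B - \<bar>p\<bar> - x - y \<le> int t \<and>
    (\<forall>i<k. w i \<noteq> v i \<longrightarrow> (\<exists>j\<in>{-A..<B}. int i = j mod int k))"
  using assms(1)
proof (induction t arbitrary: c w)
  case 0
  then show ?case
    by (intro exI[of _ 0]) (auto simp: \<open>k > 0\<close>)
next
  case (Suc t)
  obtain c1 w1 where 1: "((0, v), (c1, w1)) \<in> parcs (DPillar n k) ^^ t"
    and arc: "((c1, w1), (c, w)) \<in> parcs (DPillar n k)"
    using Suc.prems by (metis relpow_Suc_E surj_pair)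
  obtain p A B x y :: int where p: "int c1 = p mod int k"
    and xy: "0 \<le> x" "x \<le> 1" "0 \<le> y" "y \<le> 1" "x \<le> A" "y \<le> B" "x - A \<le> p" "p \<le> B - y"
    and t: "2 * A + 2 * B - \<bar>p\<bar> - x - y \<le> int t"
    and cov: "\<forall>i<k. w1 i \<noteq> v i \<longrightarrow> (\<exists>j\<in>{-A..<B}. int i = j mod int k)"
    using Suc.IH[OF 1] by blast
  \<comment> \<open>A hop rewrites a single bit \<open>e\<close>, so coverage survives once the
    interval is enlarged to contain a lift \<open>q\<close> of \<open>e\<close>.\<close>
  have cov': "\<forall>i<k. w i \<noteq> v i \<longrightarrow> (\<exists>j\<in>{-A'..<B'}. int i = j mod int k)"
    if "w = w1(e := z)" "int e = q mod int k" "A \<le> A'" "B \<le> B'" "- A' \<le> q" "q < B'"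
    for e z q A' B'
  proof (intro allI impI)
    fix i assume "i < k" "w i \<noteq> v i"
    show "\<exists>j\<in>{-A'..<B'}. int i = j mod int k"
    proof (cases "i = e")
      case True
      then show ?thesis using that by auto
    next
      case False
      then obtain j where "j \<in> {-A..<B}" "int i = j mod int k"
        using cov \<open>i < k\<close> \<open>w i \<noteq> v i\<close> \<open>w = w1(e := z)\<close> by auto
      then show ?thesis using that by auto
    qed
  qed
  have step: ?case
    if "int c = p' mod int k" "0 \<le> x'" "x' \<le> 1" "0 \<le> y'" "y' \<le> 1" "x' \<le> A'" "y' \<le> B'"
      "x' - A' \<le> p'" "p' \<le> B' - y'" "A' + A' + B' + B' - \<bar>p'\<bar> - x' - y' \<le> int t + 1"
      "\<forall>i<k. w i \<noteq> v i \<longrightarrow> (\<exists>j\<in>{-A'..<B'}. int i = j mod int k)"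
    for p' x' y' A' B' :: int
  proof -
    have "2 * A' + 2 * B' - \<bar>p'\<bar> - x' - y' \<le> int (Suc t)" using that by linarith
    then show ?thesis using that by blast
  qed
  from arc show ?case
  proof (cases rule: DPillar_arcE)
    case (up z)
    have c: "int c = (p + 1) mod int k" using up p by (simp add: int_next_col)
    show ?thesis
    proof (cases "p < B - y")
      case True
      show ?thesis
        by (rule step[of "p + 1" x y A B, OF c _ _ _ _ _ _ _ _ _ cov'[OF up(3) p]])
          (use True xy t in linarith)+
    next
      \<comment> \<open>Here \<open>p = B - y\<close>. If \<open>y = 1\<close>, the last edge is now
        traversed and only \<open>y\<close> drops to 0; if \<open>y = 0\<close>, the range grows by
        one edge. Both add at most 1 to the bound, since \<open>p\<close> is nonnegative and grows
        too.\<close>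
      case False
      show ?thesis
        by (rule step[of "p + 1" x 0 A "p + 1", OF c _ _ _ _ _ _ _ _ _ cov'[OF up(3) p]])
          (use False xy t in linarith)+
    qed
  next
    case (down z)
    have e: "int (prev_col k c1) = (p - 1) mod int k" and c: "int c = (p - 1) mod int k"
      using down p by (simp_all add: int_prev_col)
    show ?thesis
    proof (cases "x - A < p")
      case True
      show ?thesis
        by (rule step[of "p - 1" x y A B, OF c _ _ _ _ _ _ _ _ _ cov'[OF down(3) e]])
          (use True xy t in linarith)+
    next
      case False
      show ?thesis
        by (rule step[of "p - 1" 0 y "1 - p" B, OF c _ _ _ _ _ _ _ _ _ cov'[OF down(3) e]])
          (use False xy t in linarith)+
    qed
  next
    case (stay_next z)
    have c: "int c = p mod int k" using stay_next p by simp
    show ?thesis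
    proof (cases "p < B")
      case True
      show ?thesis
        by (rule step[of p x y A B, OF c _ _ _ _ _ _ _ _ _ cov'[OF stay_next(3) p]])
          (use True xy t in linarith)+
    next
      \<comment> \<open>This forces \<open>p = B\<close> and \<open>y = 0\<close>: the edge beyond
        the range is touched without being traversed, adding 2 - 1 to the bound.\<close>
      case False
      show ?thesis
        by (rule step[of p x 1 A "B + 1", OF c _ _ _ _ _ _ _ _ _ cov'[OF stay_next(3) p]])
          (use False xy t in linarith)+
    qed
  next
    case (stay_prev z)
    have e: "int (prev_col k c1) = (p - 1) mod int k" and c: "int c = p mod int k"
      using stay_prev p by (simp_all add: int_prev_col)
    show ?thesis
    proof (cases "- A < p")
      case True
      show ?thesis
        by (rule step[of p x y A B, OF c _ _ _ _ _ _ _ _ _ cov'[OF stay_prev(3) e]])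
          (use True xy t in linarith)+
    next
      case False
      show ?thesis
        by (rule step[of p 1 y "A + 1" B, OF c _ _ _ _ _ _ _ _ _ cov'[OF stay_prev(3) e]])
          (use False xy t in linarith)+
    qed
  qed
qed

text \<open>The \<open>A + B\<close> integers of the touched interval must cover all
  \<open>k\<close> residues, and \<open>x + y\<close> saves at most 2.\<close>

lemma DPillar_walk_length:
  assumes "((0, v), (c, w)) \<in> parcs (DPillar n k) ^^ t" "k > 0" "\<forall>i<k. w i \<noteq> v i"
  obtains p where "int c = p mod int k" "\<bar>p\<bar> \<le> int t" "2 * int k - 2 - \<bar>p\<bar> \<le> int t"
proof -
  obtain p A B x y :: int where p: "int c = p mod int k"
    and xy: "0 \<le> x" "x \<le> 1" "0 \<le> y" "y \<le> 1" "x \<le> A" "y \<le> B" "x - A \<le> p" "p \<le> B - y"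
    and t: "2 * A + 2 * B - \<bar>p\<bar> - x - y \<le> int t"
    and cov: "\<forall>i<k. w i \<noteq> v i \<longrightarrow> (\<exists>j\<in>{-A..<B}. int i = j mod int k)"
    using DPillar_walk_invariant[OF assms(1,2)] by blast
  have "int ` {..<k} \<subseteq> (\<lambda>j. j mod int k) ` {-A..<B}" using cov assms(3) by auto
  then have "card (int ` {..<k}) \<le> card {-A..<B}"
    by (rule surj_card_le[rotated]) simp
  then have "int k \<le> A + B" using xy by (auto simp: card_image)
  then have "2 * int k - 2 \<le> 2 * A + 2 * B - x - y" using xy by linarith
  then have "2 * int k - 2 - \<bar>p\<bar> \<le> int t" using t by linarith
  moreover have "\<bar>p\<bar> \<le> int t" using xy t by linarith
  ultimately show thesis using that[OF p] by blast
qed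

lemma DPillar_diameter_ge:
  assumes "k > 0" "n \<ge> 4" "d < k"
    and len: "\<And>p t. int d = p mod int k \<Longrightarrow> \<bar>p\<bar> \<le> t \<Longrightarrow> 2 * int k - 2 - \<bar>p\<bar> \<le> t \<Longrightarrow> int l \<le> t"
  shows "ereal (real l) \<le> digraph_diameter (with_proj (DPillar n k))"
proof -
  \<comment> \<open>All-zero and all-one rows force every bit to change; the digit 1 is legal
    because \<open>n\<close> is at least 4.\<close>
  define v w where "v = (\<lambda>i\<in>{0..<k}. 0 :: nat)" and "w = (\<lambda>i\<in>{0..<k}. 1 :: nat)"
  have vw: "\<forall>i<k. w i \<noteq> v i" by (simp add: v_def w_def)
  have nodes: "(0, v) \<in> dpillar_nodes n k" "(d, w) \<in> dpillar_nodes n k"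
    using assms by (auto simp: dpillar_nodes_def v_def w_def)
  show ?thesis
  proof (rule digraph_diameter_DPillar_ge[OF nodes])
    show "(0, v) \<noteq> (d, w)" using vw \<open>k > 0\<close> by auto
  next
    fix t assume "((0, v), (d, w)) \<in> parcs (DPillar n k) ^^ t"
    then show "l \<le> t"
      by (rule DPillar_walk_length[OF _ \<open>k > 0\<close> vw]) (use len[of _ "int t"] in auto)
  qed
qed

section \<open>Upper bound\<close>

context
  fixes n k :: nat and E :: "(server \<times> server) set"
  assumes k: "k \<ge> 2"
  defines "E \<equiv> (parcs (DPillar n k))\<^sup>="
begin

lemma prev_next_col: "c < k \<Longrightarrow> prev_col k (next_col k c) = c"
  and next_prev_col: "c < k \<Longrightarrow> next_col k (prev_col k c) = c"
  using k by (auto simp: next_col_def prev_col_def mod_if)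

lemma col_less: "next_col k c < k" "prev_col k c < k"
  using k by (auto simp: next_col_def prev_col_def)

lemma E_next: "(c, v) \<in> dpillar_nodes n k \<Longrightarrow> x < n div 2 \<Longrightarrow>
    ((c, v), (next_col k c, v(c := x))) \<in> E"
  by (auto simp: E_def DPillar_def c_edges_def)

lemma E_prev: "(c, v) \<in> dpillar_nodes n k \<Longrightarrow> x < n div 2 \<Longrightarrow>
    ((c, v), (prev_col k c, v(prev_col k c := x))) \<in> E"
  by (auto simp: E_def DPillar_def a_edges_def)

text \<open>Rewriting a bit to its present value is no b-edge or d-edge, but an idle step of
  \<open>E\<close>.\<close>

lemma E_stay:
  assumes "(c, v) \<in> dpillar_nodes n k" "x < n div 2" "e = c \<or> e = prev_col k c"
  shows "((c, v), (c, v(e := x))) \<in> E"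
proof (cases "v e = x")
  case True
  then show ?thesis by (auto simp: E_def)
next
  case False
  then show ?thesis using assms by (auto simp: E_def DPillar_def b_edges_def d_edges_def)
qed

lemma node_bit: "(c, v) \<in> dpillar_nodes n k \<Longrightarrow> i < k \<Longrightarrow> v i < n div 2"
  by (auto simp: dpillar_nodes_def PiE_iff)

text \<open>Restoring the old bit undoes a hop: a-edges and c-edges reverse each other, while
  b-edges and d-edges reverse within their own kind.\<close>

lemma sym_E: "sym E"
proof -
  have "((c', v'), (c, v)) \<in> E"
    if arc: "((c, v), (c', v')) \<in> parcs (DPillar n k)" for c v c' v'
  proof -
    interpret D: pair_fin_digraph "DPillar n k" by (rule pair_fin_digraph_DPillar)
    have nodes: "(c, v) \<in> dpillar_nodes n k" "(c', v') \<in> dpillar_nodes n k"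
      using D.in_arcsD1[OF arc] D.in_arcsD2[OF arc] by (auto simp: DPillar_def)
    have bit: "v i < n div 2" if "i < k" for i using node_bit nodes that by blast
    from arc show ?thesis
    proof (cases rule: DPillar_arcE)
      case (up x)
      then show ?thesis using E_prev[OF nodes(2) bit[of c]] by (simp add: prev_next_col)
    next
      case (down x)
      then show ?thesis
        using E_next[OF nodes(2) bit[of "prev_col k c"]] by (simp add: next_prev_col col_less)
    next
      case (stay_next x)
      then show ?thesis using E_stay[OF nodes(2) bit[of c], of c] by simp
    next
      case (stay_prev x)
      then show ?thesis
        using E_stay[OF nodes(2) bit[of "prev_col k c"], of "prev_col k c"] by (auto simp: col_less)
    qed
  qed
  then show ?thesis by (auto simp: sym_def E_def)
qed

lemma E_relpow_trans: "(u, v) \<in> E ^^ a \<Longrightarrow> (v, w) \<in> E ^^ b \<Longrightarrow> (u, w) \<in> E ^^ (a + b)"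
  by (auto simp: relpow_add)

lemma E_relpow_sym: "(u, v) \<in> E ^^ a \<Longrightarrow> (v, u) \<in> E ^^ a"
proof (induction a arbitrary: v)
  case (Suc a)
  then show ?case using sym_E by (meson relpow_Suc_E relpow_Suc_I2 symD)
qed simp

lemma E_relpow_mono: "(u, v) \<in> E ^^ a \<Longrightarrow> a \<le> b \<Longrightarrow> (u, v) \<in> E ^^ b"
proof (induction b)
  case (Suc b)
  then show ?case by (cases "a = Suc b") (auto simp: E_def le_Suc_eq)
qed simp

text \<open>Along the routes below, \<open>override_on v w S\<close> is the row whose positions in
  \<open>S\<close> already carry their target bits.\<close>

lemma override_node:
  assumes "(c, v) \<in> dpillar_nodes n k" "(d, w) \<in> dpillar_nodes n k" "b < k"
  shows "(b, override_on v w S) \<in> dpillar_nodes n k"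
  using assms by (auto simp: dpillar_nodes_def PiE_iff override_on_def extensional_def)

lemma override_all:
  assumes "(c, v) \<in> dpillar_nodes n k" "(d, w) \<in> dpillar_nodes n k" "{..<k} \<subseteq> S"
  shows "override_on v w S = w"
proof
  fix i
  show "override_on v w S i = w i"
    using assms by (cases "i < k")
      (auto simp: dpillar_nodes_def PiE_iff override_on_def extensional_def)
qed

text \<open>A run of c-edges corrects the position of each column it leaves. Unreduced naturals
  \<open>p\<close> and \<open>j\<close> keep the swept positions an interval across the
  wrap-around.\<close>

lemma E_sweep:
  assumes "(c, v) \<in> dpillar_nodes n k" "(d, w) \<in> dpillar_nodes n k"
  shows "((p mod k, override_on v w S),
    ((p + j) mod k, override_on v w (S \<union> (\<lambda>i. i mod k) ` {p..<p + j}))) \<in> E ^^ j"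
proof (induction j)
  case (Suc j)
  let ?S = "S \<union> (\<lambda>i. i mod k) ` {p..<p + j}" and ?q = "(p + j) mod k"
  have "?q < k" using k by simp
  have "(\<lambda>i. i mod k) ` {p..<p + Suc j} = insert ?q ((\<lambda>i. i mod k) ` {p..<p + j})"
    by (simp add: atLeastLessThanSuc)
  then have eq: "override_on v w (S \<union> (\<lambda>i. i mod k) ` {p..<p + Suc j}) =
      (override_on v w ?S)(?q := w ?q)"
    by (simp add: override_on_insert)
  have "((?q, override_on v w ?S), (next_col k ?q, (override_on v w ?S)(?q := w ?q))) \<in> E"
    using override_node[OF assms \<open>?q < k\<close>] node_bit[OF assms(2) \<open>?q < k\<close>] by (rule E_next)
  moreover have "next_col k ?q = (p + Suc j) mod k" by (simp add: next_col_def mod_simps)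
  ultimately show ?case using Suc.IH eq by (metis relpow_Suc_I)
qed simp

lemma E_stay_override:
  assumes "(c, v) \<in> dpillar_nodes n k" "(d, w) \<in> dpillar_nodes n k" "b < k"
    "e = b \<or> e = prev_col k b"
  shows "((b, override_on v w S), (b, override_on v w (insert e S))) \<in> E ^^ 1"
proof -
  have "e < k" using assms(3,4) col_less by auto
  then show ?thesis
    using E_stay[OF override_node[OF assms(1-3)] node_bit[OF assms(2)] assms(4)]
    by (simp add: override_on_insert)
qed

lemma residues_subset: "{..<k} \<subseteq> (\<lambda>i. i mod k) ` {q..<q + k}"
proof
  fix i assume "i \<in> {..<k}"
  \<comment> \<open>The representative of \<open>i\<close> in the window; the summand
    \<open>k\<close> keeps the subtraction from truncating.\<close>
  define j where "j = q + (i + k - q mod k) mod k"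
  have "q mod k \<le> i + k" using k by (simp add: le_trans[OF mod_le_divisor] trans_le_add2)
  have "j mod k = (q mod k + (i + k - q mod k)) mod k" by (simp only: j_def mod_simps)
  also have "\<dots> = i"
    using \<open>q mod k \<le> i + k\<close> \<open>i \<in> {..<k}\<close> by (simp only: le_add_diff_inverse) simp
  finally have "i = j mod k" by simp
  moreover have "j \<in> {q..<q + k}" using k by (simp add: j_def)
  ultimately show "i \<in> (\<lambda>i. i mod k) ` {q..<q + k}" by (rule image_eqI)
qed

lemma E_round_trip:
  assumes "(c, v) \<in> dpillar_nodes n k" "(c, w) \<in> dpillar_nodes n k"
  shows "((c, v), (c, w)) \<in> E ^^ k"
proof -
  have "c < k" using assms(1) by (rule dpillar_nodes_col)
  then show ?thesis
    using E_sweep[OF assms, of c "{}" k] override_all[OF assms residues_subset, of c] by simp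
qed

text \<open>After \<open>k - 1\<close> c-edges only the bit of the arrival column is left, and a
  b-edge corrects it.\<close>

lemma E_sweep_adjacent:
  assumes "(c, v) \<in> dpillar_nodes n k" "((c + (k - 1)) mod k, w) \<in> dpillar_nodes n k"
  shows "((c, v), ((c + (k - 1)) mod k, w)) \<in> E ^^ k"
proof -
  let ?S = "(\<lambda>i. i mod k) ` {c..<c + (k - 1)}" and ?q = "(c + (k - 1)) mod k"
  have "c < k" using assms(1) by (rule dpillar_nodes_col)
  have "((c, v), (?q, override_on v w ?S)) \<in> E ^^ (k - 1)"
    using E_sweep[OF assms, of c "{}" "k - 1"] \<open>c < k\<close> by simp
  moreover have "((?q, override_on v w ?S), (?q, override_on v w (insert ?q ?S))) \<in> E ^^ 1"
    using k by (intro E_stay_override[OF assms]) auto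
  moreover have "insert ?q ?S = (\<lambda>i. i mod k) ` {c..<c + k}"
  proof -
    have "{c..<c + k} = insert (c + (k - 1)) {c..<c + (k - 1)}" using k by auto
    then show ?thesis by simp
  qed
  moreover have "k - 1 + 1 = k" using k by simp
  ultimately show ?thesis
    using override_all[OF assms residues_subset, of c] E_relpow_trans by metis
qed

text \<open>The route: a d-edge for the bit behind \<open>c\<close>, then \<open>k - 2\<close>
  c-edges, a b-edge at the turning column, and \<open>k - 2 - e\<close> hops back.\<close>

lemma E_turn_around:
  assumes "(c, v) \<in> dpillar_nodes n k" "((c + e) mod k, w) \<in> dpillar_nodes n k" "e \<le> k - 2"
  shows "((c, v), ((c + e) mod k, w)) \<in> E ^^ (2 * k - 2 - e)"
proof -
  let ?m = "\<lambda>i. i mod k"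
  \<comment> \<open>Starting at \<open>c + k\<close> rather than \<open>c\<close> makes room for the
    position \<open>c + k - 1\<close> behind the start, also when \<open>c = 0\<close>.\<close>
  let ?T = "?m ` {c + k..<c + k + (k - 2)}" and ?q = "(c + k + (k - 2)) mod k"
  have "c < k" using assms(1) by (rule dpillar_nodes_col)
  have "override_on v w {} = v" by simp
  then have "((c, v), (c, override_on v w {prev_col k c})) \<in> E ^^ 1"
    using E_stay_override[OF assms(1,2) \<open>c < k\<close>, of "prev_col k c" "{}"] by simp
  also have "prev_col k c = (c + k - 1) mod k" by (simp add: prev_col_def)
  finally have 1: "((c, v), (c, override_on v w {?m (c + k - 1)})) \<in> E ^^ 1" .
  have 2: "((c, override_on v w {?m (c + k - 1)}),
      (?q, override_on v w ({?m (c + k - 1)} \<union> ?T))) \<in> E ^^ (k - 2)"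
    using E_sweep[OF assms(1,2), of "c + k" "{?m (c + k - 1)}" "k - 2"] \<open>c < k\<close> by simp
  have 3: "((?q, override_on v w ({?m (c + k - 1)} \<union> ?T)),
      (?q, override_on v w (insert ?q ({?m (c + k - 1)} \<union> ?T)))) \<in> E ^^ 1"
    using k by (intro E_stay_override[OF assms(1,2)]) auto
  have "{c + k - 1..<c + k - 1 + k} =
      insert (c + k + (k - 2)) ({c + k - 1} \<union> {c + k..<c + k + (k - 2)})"
    using k by auto
  then have "?m ` {c + k - 1..<c + k - 1 + k} = insert ?q ({?m (c + k - 1)} \<union> ?T)"
    by (simp only: image_insert image_Un image_empty)
  then have all: "override_on v w (insert ?q ({?m (c + k - 1)} \<union> ?T)) = w"
    using override_all[OF assms(1,2) residues_subset, of "c + k - 1"] by simp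
  have "override_on w w S = w" for S by (simp add: override_on_def)
  \<comment> \<open>The way back is a forward sweep that changes no bit, reversed by
    symmetry.\<close>
  then have "(((c + e) mod k, w), ((c + e + (k - 2 - e)) mod k, w)) \<in> E ^^ (k - 2 - e)"
    using E_sweep[OF assms(2,2), of "c + e" "{}" "k - 2 - e"] by simp
  moreover have "(c + e + (k - 2 - e)) mod k = ?q"
    using assms(3) by (metis add.assoc add.commute le_add_diff_inverse mod_add_self1)
  ultimately have 4: "((?q, w), ((c + e) mod k, w)) \<in> E ^^ (k - 2 - e)"
    using E_relpow_sym by simp
  have "((c, v), ((c + e) mod k, w)) \<in> E ^^ (1 + (k - 2) + 1 + (k - 2 - e))"
    using E_relpow_trans[OF E_relpow_trans[OF E_relpow_trans[OF 1 2] 3[unfolded all]] 4] .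
  moreover have "1 + (k - 2) + 1 + (k - 2 - e) = 2 * k - 2 - e" using k assms(3) by simp
  ultimately show ?thesis by metis
qed

lemma E_relpow_max:
  assumes nodes: "u \<in> dpillar_nodes n k" "w \<in> dpillar_nodes n k"
  shows "(u, w) \<in> E ^^ max k (k + k div 2 - 2)"
proof -
  text \<open>Going backwards is handled by reversing a walk from \<open>w\<close> to \<open>u\<close>.\<close>
  have fwd: "((c, v), (d, v')) \<in> E ^^ max k (k + k div 2 - 2)"
    if "(c, v) \<in> dpillar_nodes n k" "(d, v') \<in> dpillar_nodes n k"
      \<comment> \<open>The lower limit on \<open>e\<close> makes the turn-around cost
        \<open>2 * k - 2 - e\<close> at most \<open>k + k div 2 - 2\<close>.\<close>
      "d = (c + e) mod k" and e: "e = 0 \<or> e = k - 1 \<or> (k - k div 2 \<le> e \<and> e \<le> k - 2)" for c v d v' e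
  proof -
    have "c < k" using that(1) by (rule dpillar_nodes_col)
    consider "e = 0" | "e = k - 1" | "k - k div 2 \<le> e" "e \<le> k - 2" using e by blast
    then show ?thesis
    proof cases
      case 1
      then show ?thesis
        using E_round_trip[of c v v'] that \<open>c < k\<close> by (auto intro: E_relpow_mono)
    next
      case 2
      then show ?thesis
        using E_sweep_adjacent[of c v v'] that by (auto intro: E_relpow_mono)
    next
      case 3
      then have "2 * k - 2 - e \<le> max k (k + k div 2 - 2)" by linarith
      then show ?thesis
        using E_turn_around[of c v e v'] that 3 by (auto intro: E_relpow_mono)
    qed
  qed
  obtain c v d v' where uw: "u = (c, v)" "w = (d, v')" by (metis surj_pair)
  have cd: "c < k" "d < k" using nodes uw dpillar_nodes_col by auto
  define e where "e = (if c \<le> d then d - c else d + k - c)"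
  define e' where "e' = (if d \<le> c then c - d else c + k - d)"
  have e: "d = (c + e) mod k" "c = (d + e') mod k" using cd by (auto simp: e_def e'_def)
  have sum: "e = 0 \<or> e + e' = k" "e < k" using cd by (auto simp: e_def e'_def)
  show ?thesis
  proof (cases "e = 0 \<or> e = k - 1 \<or> (k - k div 2 \<le> e \<and> e \<le> k - 2)")
    case True
    then show ?thesis using fwd[OF nodes[unfolded uw] e(1)] unfolding uw by blast
  next
    case False
    \<comment> \<open>The opposite distance \<open>e' = k - e\<close> exceeds
      \<open>k div 2\<close>, so it lies in the range that \<open>fwd\<close> handles.\<close>
    then have "0 < e" "e < k - k div 2" "e + e' = k" using sum by auto
    then have "e' = k - 1 \<or> (k - k div 2 \<le> e' \<and> e' \<le> k - 2)" by linarith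
    then have "(w, u) \<in> E ^^ max k (k + k div 2 - 2)"
      using fwd[OF nodes(2,1)[unfolded uw] e(2)] unfolding uw by blast
    then show ?thesis by (rule E_relpow_sym)
  qed
qed

end

section \<open>Comparison of the two bounds\<close>

theorem theorem5:
  fixes n k :: nat
  assumes "k \<ge> 2" and "even n" and "n \<ge> 4"
  shows "(k \<in> {2, 3} \<longrightarrow> digraph_diameter (with_proj (DPillar n k)) = ereal (real k)) \<and>
         (k \<ge> 4 \<longrightarrow> digraph_diameter (with_proj (DPillar n k)) = ereal (real (k + k div 2 - 2)))"
proof -
  let ?diam = "digraph_diameter (with_proj (DPillar n k))"
  have upper: "?diam \<le> ereal (real (max k (k + k div 2 - 2)))"
    using E_relpow_max[OF assms(1)] by (rule digraph_diameter_DPillar_le)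
  \<comment> \<open>The lifts of column \<open>d\<close> are \<open>d + m * k\<close>. For
    \<open>m\<close> at most -2 the absolute value is at least \<open>2 * k - d\<close>, hence at
    least \<open>k + d\<close> as \<open>2 * d \<le> k\<close>.\<close>
  have lift: "p = int d \<or> p = int d - int k \<or> int d + int k \<le> \<bar>p\<bar>"
    if "int d = p mod int k" "2 * d \<le> k" for d p
  proof -
    have p: "p = int d + int k * (p div int k)" using that(1) by simp
    consider "p div int k = 0" | "p div int k = - 1" | "p div int k \<ge> 1" | "p div int k \<le> - 2"
      by linarith
    then show ?thesis
    proof cases
      case 3
      then have "int k * 1 \<le> int k * (p div int k)" by (intro mult_left_mono) auto
      then show ?thesis using p by linarith
    next
      case 4
      then have "int k * (p div int k) \<le> int k * (- 2)" by (intro mult_left_mono) auto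
      then show ?thesis using p that(2) by linarith
    qed (use p in auto)
  qed
  \<comment> \<open>For \<open>d > 0\<close>, the lifts \<open>d\<close> and \<open>d - k\<close>
    both cost at least \<open>k + d - 2\<close>. For \<open>d = 0\<close>, the lift 0 costs
    \<open>2 * k - 2\<close> and the lift \<open>-k\<close> costs \<open>k\<close>. The choice
    \<open>d = 0\<close> serves \<open>k \<le> 3\<close>, and \<open>d = k div 2\<close> serves
    \<open>k \<ge> 4\<close>.\<close>
  have lower: "ereal (real l) \<le> ?diam"
    if "2 * d \<le> k" "l \<le> k + d" "d = 0 \<longrightarrow> l \<le> k" "d > 0 \<longrightarrow> l \<le> k + d - 2" for d l
  proof (rule DPillar_diameter_ge)
    show "d < k" "k > 0" "n \<ge> 4" using that assms by auto
  next
    fix p t :: int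
    assume "int d = p mod int k" "\<bar>p\<bar> \<le> t" "2 * int k - 2 - \<bar>p\<bar> \<le> t"
    then show "int l \<le> t" using lift[of d p] that assms(1) by (cases "d = 0") auto
  qed
  show ?thesis
  proof (intro conjI impI)
    assume "k \<in> {2, 3}"
    then have "max k (k + k div 2 - 2) = k" by auto
    then show "?diam = ereal (real k)" using upper lower[of 0 k] by (intro antisym) auto
  next
    assume "k \<ge> 4"
    then have "k div 2 \<ge> 2" by simp
    then have "max k (k + k div 2 - 2) = k + k div 2 - 2" by simp
    then show "?diam = ereal (real (k + k div 2 - 2))"
      using upper lower[of "k div 2" "k + k div 2 - 2"] \<open>k div 2 \<ge> 2\<close> by (intro antisym) auto
  qed
qed

end
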